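(* Let $\mathcal{A}$ be a complex Banach algebra with unity, $a,b\in\mathcal{A}$ and $k$ a positive integer. Suppose $ab\alpha_{1}\alpha_{2}\cdots\alpha_{k}=0$ for all $\alpha_{1},\dots,\alpha_{k}\in\{a,b\}$. Then $a$ and $b$ are both g$\pi$-Hirano invertible if and only if $a+b$ is g$\pi$-Hirano invertible.
   Context: $\mathcal{A}^{qnil}$ denotes the set of quasinilpotent elements of $\mathcal{A}$ (spectrum equal to $\{0\}$). An element $a\in\mathcal{A}$ is g$\pi$-Hirano invertible if there exists $x\in\mathcal{A}$ with $xax=x$, $ax=xa$ and $a-a^{n+2}x\in\mathcal{A}^{qnil}$ for some positive integer $n$. *)

theory Defs
  imports "HOL-Analysis.Analysis"
begin

class complex_banach_algebra_1 = banach + real_normed_algebra_1 +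
  fixes scaleC :: "complex \<Rightarrow> 'a \<Rightarrow> 'a"
  assumes scaleC_add_right: "scaleC c (x + y) = scaleC c x + scaleC c y"
    and scaleC_add_left: "scaleC (c + d) x = scaleC c x + scaleC d x"
    and scaleC_scaleC: "scaleC c (scaleC d x) = scaleC (c * d) x"
    and scaleC_one: "scaleC 1 x = x"
    and scaleC_of_real: "scaleC (complex_of_real r) x = scaleR r x"
    and scaleC_mult_left: "scaleC c x * y = scaleC c (x * y)"
    and scaleC_mult_right: "x * scaleC c y = scaleC c (x * y)"
    and norm_scaleC: "norm (scaleC c x) = cmod c * norm x"

definition ba_invertible :: "'a::ring_1 \<Rightarrow> bool" where
  "ba_invertible x \<longleftrightarrow> (\<exists>y. x * y = 1 \<and> y * x = 1)"

definition ba_spectrum :: "'a::complex_banach_algebra_1 \<Rightarrow> complex set" where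
  "ba_spectrum x = {z. \<not> ba_invertible (x - scaleC z 1)}"

definition quasinilpotent :: "'a::complex_banach_algebra_1 \<Rightarrow> bool" where
  "quasinilpotent x \<longleftrightarrow> ba_spectrum x = {0}"

definition gpi_Hirano_invertible :: "'a::complex_banach_algebra_1 \<Rightarrow> bool" where
  "gpi_Hirano_invertible a \<longleftrightarrow>
     (\<exists>x. x * a * x = x \<and> a * x = x * a \<and>
          (\<exists>n::nat. n > 0 \<and> quasinilpotent (a - a ^ (n + 2) * x)))"

end

(* The key equivalence: a is g-pi-Hirano invertible iff for some n > 0 every point z of its spectrum
   satisfies z^(n+1) = z. For "only if", the corners of the idempotent ax reduce the resolvent of a
   to that of the quasinilpotent part; for "if", the Riesz projection for a disc of radius 1/2 gives x.
   The Riesz projection is the limit of (1 - c^(2^i))^{-1} as i grows, and the same limits show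
   that spectra are nonempty, so that no contour integrals are needed.

   For z nonzero, (a - z)(b - z) = ab - z(a + b - z). The hypothesis makes ab annihilate all long words,
   so ab times products of resolvents is nilpotent and the term ab does not affect invertibility. Hence
   a - z and b - z invertible make a + b - z invertible, and conversely a + b - z invertible makes a - z
   right invertible; off a finite set of z this already forces a - z to be invertible. *)

theory Submission
  imports Defs "HOL-Computational_Algebra.Fundamental_Theorem_Algebra"
begin

text \<open>For N = 2^i, the mean of (1 - v c)^{-1} over the N-th roots v of 1 is (1 - c^N)^{-1}.
  With z = 1/v the summand is z (z - c)^{-1}, so this mean is a Riemann sum for the integral of the
  resolvent of c over the unit circle, divided by 2 pi i. Doubling N amounts to averaging over two
  square roots, so a Lipschitz bound on the circle suffices for convergence. Nonempty spectra matter
  because quasinilpotency demands a spectrum equal to {0}, and inverting x - z for nonzero z only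
  shows inclusion. The equation z^(n+1) = z confines the spectrum to 0 and the n-th roots of unity.
  Hence every circle about 0 with radius strictly between 0 and 1 separates the two parts (1/2 is
  one choice), and the exceptional set is finite. At z = 0 the equation holds automatically, so
  dividing by z loses nothing. The hypothesis is not symmetric in a and b, and a right inverse in a
  Banach algebra need not be two-sided; this is why the converse needs a connectedness
  argument.\<close>

interpretation scaleC: vector_space scaleC
  by unfold_locales (simp_all add: scaleC_add_right scaleC_add_left scaleC_scaleC scaleC_one)

lemma scaleC_1_mult: "scaleC c 1 * x = scaleC c x" "x * scaleC c 1 = scaleC c x"
  by (simp_all add: scaleC_mult_left scaleC_mult_right)

lemma bounded_bilinear_scaleC: "bounded_bilinear scaleC"
proof
  show "scaleC (scaleR r c) x = scaleR r (scaleC c x)" for r c and x :: 'a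
    by (simp only: scaleR_conv_of_real[of r c] scaleC_of_real[symmetric] scaleC_scaleC)
  show "scaleC c (scaleR r x) = scaleR r (scaleC c x)" for r c and x :: 'a
    by (simp only: scaleC_of_real[symmetric] scaleC_scaleC mult.commute)
  show "\<exists>K. \<forall>c x. norm (scaleC c x :: 'a) \<le> norm c * norm x * K"
    by (rule exI[of _ 1]) (simp add: norm_scaleC)
qed (simp_all add: scaleC_add_left scaleC_add_right)

lemmas continuous_on_scaleC [continuous_intros] =
  bounded_bilinear.continuous_on[OF bounded_bilinear_scaleC]

lemma power_scaleC: "scaleC c x ^ n = scaleC (c ^ n) (x ^ n)"
  by (induction n) (simp_all add: scaleC_mult_left scaleC_mult_right scaleC_scaleC mult_ac)

subsection \<open>Inverses and the Neumann series\<close>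

definition ba_inverse :: "'a::ring_1 \<Rightarrow> 'a" where
  "ba_inverse x = (THE y. x * y = 1 \<and> y * x = 1)"

lemma ba_inverse_eqI:
  assumes "x * y = 1" "y * x = 1"
  shows "ba_inverse x = y"
  unfolding ba_inverse_def
proof (rule the_equality)
  fix z assume "x * z = 1 \<and> z * x = 1"
  then show "z = y" using assms by (metis mult.assoc mult_1_left mult_1_right)
qed (use assms in auto)

lemma ba_invertibleI: "x * y = 1 \<Longrightarrow> y * x = 1 \<Longrightarrow> ba_invertible x"
  unfolding ba_invertible_def by blast

lemma ba_inverse_right [simp]: "ba_invertible x \<Longrightarrow> x * ba_inverse x = 1"
  and ba_inverse_left [simp]: "ba_invertible x \<Longrightarrow> ba_inverse x * x = 1"
  unfolding ba_invertible_def using ba_inverse_eqI by auto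

lemma ba_inverse_right' [simp]: "ba_invertible x \<Longrightarrow> x * (ba_inverse x * y) = y"
  and ba_inverse_left' [simp]: "ba_invertible x \<Longrightarrow> ba_inverse x * (x * y) = y"
  by (simp_all flip: mult.assoc)

lemma ba_invertible_1 [simp]: "ba_invertible 1"
  and ba_inverse_1 [simp]: "ba_inverse 1 = 1"
  by (auto intro: ba_invertibleI[of _ 1] ba_inverse_eqI)

lemma ba_invertible_mult:
  assumes "ba_invertible x" "ba_invertible y"
  shows "ba_invertible (x * y)"
  by (rule ba_invertibleI[of _ "ba_inverse y * ba_inverse x"]) (simp_all add: assms mult.assoc)

lemma ba_inverse_commute:
  assumes "ba_invertible x" "x * y = y * x"
  shows "ba_inverse x * y = y * ba_inverse x"
  by (metis assms ba_inverse_left ba_inverse_right mult.assoc mult_1_left mult_1_right)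

lemma ba_invertible_left_right:
  assumes "l * x = 1" "x * r = 1"
  shows "ba_invertible x"
  by (metis assms ba_invertibleI mult.assoc mult_1_left mult_1_right)

lemma ba_invertible_factor:
  assumes "ba_invertible (x * y)" "x * y = y * x"
  shows "ba_invertible x"
proof (rule ba_invertible_left_right)
  show "x * (y * ba_inverse (x * y)) = 1"
    using assms(1) by (metis mult.assoc ba_inverse_right)
  show "(ba_inverse (x * y) * y) * x = 1"
    using assms by (metis mult.assoc ba_inverse_left)
qed

lemma ba_invertible_of_mult:
  assumes "ba_invertible (x * y)" "ba_invertible x"
  shows "ba_invertible y"
  using ba_invertible_mult[of "ba_inverse x" "x * y"] assms
  by (metis ba_inverse_left' ba_invertibleI ba_inverse_left ba_inverse_right)

lemma ba_invertible_scaleC_iff: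
  fixes x :: "'a::complex_banach_algebra_1"
  assumes "c \<noteq> 0"
  shows "ba_invertible (scaleC c x) \<longleftrightarrow> ba_invertible x"
proof -
  have *: "ba_invertible (scaleC c x)" if "ba_invertible x" "c \<noteq> 0" for c and x :: 'a
    by (rule ba_invertibleI[of _ "scaleC (1 / c) (ba_inverse x)"])
      (use that in \<open>simp_all add: scaleC_mult_left scaleC_mult_right scaleC_scaleC scaleC_one\<close>)
  from *[of x c] *[of "scaleC c x" "1 / c"] assms show ?thesis
    by (auto simp: scaleC_scaleC scaleC_one)
qed

lemma nilpotent_ba_invertible:
  fixes x :: "'a::ring_1"
  assumes "x ^ n = 0"
  shows "ba_invertible (1 - x)"
proof (rule ba_invertibleI)
  have *: "(1 - x) * (\<Sum>i<n. x ^ i) = 1 - x ^ n" "(\<Sum>i<n. x ^ i) * (1 - x) = 1 - x ^ n" for n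
    by (induction n) (simp_all add: distrib_left distrib_right left_diff_distrib[of 1 x "x ^ _"]
        right_diff_distrib[of "x ^ _" 1 x] power_commutes)
  show "(1 - x) * (\<Sum>i<n. x ^ i) = 1" "(\<Sum>i<n. x ^ i) * (1 - x) = 1"
    by (simp_all add: * assms)
qed

lemma neumann:
  fixes h :: "'a::{banach, real_normed_algebra_1}"
  assumes "norm h < 1"
  shows "ba_invertible (1 - h)" "norm (ba_inverse (1 - h)) \<le> 1 / (1 - norm h)"
proof -
  have sn: "summable (\<lambda>n. norm (h ^ n))"
    by (rule summable_comparison_test[OF _ summable_geometric[of "norm h"]])
      (use assms in \<open>auto simp: norm_power_ineq\<close>)
  then have s: "summable (\<lambda>n. h ^ n)" by (rule summable_norm_cancel)
  define S where "S = (\<Sum>n. h ^ n)"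
  have "h * S = (\<Sum>n. h ^ Suc n)" "S * h = (\<Sum>n. h ^ Suc n)"
    unfolding S_def by (simp_all add: suminf_mult[OF s] suminf_mult2[OF s] power_commutes)
  moreover have "(\<Sum>n. h ^ Suc n) = S - 1"
    using suminf_split_head[OF s] by (simp add: S_def)
  ultimately have inv: "(1 - h) * S = 1" "S * (1 - h) = 1" by (simp_all add: algebra_simps)
  then show "ba_invertible (1 - h)" by (rule ba_invertibleI)
  have "norm S \<le> (\<Sum>n. norm (h ^ n))" unfolding S_def by (rule summable_norm[OF sn])
  also have "\<dots> \<le> (\<Sum>n. norm h ^ n)"
    using assms by (intro suminf_le norm_power_ineq sn summable_geometric) auto
  also have "\<dots> = 1 / (1 - norm h)" using assms by (simp add: suminf_geometric)
  finally show "norm (ba_inverse (1 - h)) \<le> 1 / (1 - norm h)"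
    using ba_inverse_eqI[OF inv] by simp
qed

text \<open>Write y = (1 - h) x with h = (x - y) x^{-1} of norm at most 1/2. The Neumann series
  bounds the norm of y^{-1} by twice that of x^{-1}, and y^{-1} - x^{-1} = y^{-1} (x - y) x^{-1}
  gives the estimate.\<close>

lemma ba_inverse_perturb:
  fixes x :: "'a::{banach, real_normed_algebra_1}"
  assumes "ba_invertible x" and small: "norm (y - x) * norm (ba_inverse x) \<le> 1 / 2"
  shows "ba_invertible y"
    and "norm (ba_inverse y - ba_inverse x) \<le> 2 * norm (ba_inverse x) ^ 2 * norm (y - x)"
proof -
  define X where "X = ba_inverse x"
  define h where "h = (x - y) * X"
  have h: "norm h \<le> 1 / 2"
    unfolding h_def X_def using small norm_mult_ineq[of "x - y" "ba_inverse x"]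
    by (simp add: norm_minus_commute)
  then have inv: "ba_invertible (1 - h)" and bd: "norm (ba_inverse (1 - h)) \<le> 1 / (1 - norm h)"
    using neumann[of h] by auto
  have y: "y = (1 - h) * x"
    using assms(1) by (simp add: h_def X_def left_diff_distrib mult.assoc)
  then show yi: "ba_invertible y" using ba_invertible_mult[OF inv assms(1)] by simp
  have Y: "ba_inverse y = X * ba_inverse (1 - h)"
    by (rule ba_inverse_eqI) (simp_all add: y X_def inv assms(1) mult.assoc)
  have "norm (ba_inverse (1 - h)) \<le> 2"
    using order_trans[OF bd, of 2] h by (simp add: divide_simps)
  then have nY: "norm (ba_inverse y) \<le> norm X * 2"
    unfolding Y by (intro order.trans[OF norm_mult_ineq] mult_left_mono) auto
  have "ba_inverse y - X = ba_inverse y * (x - y) * X"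
    using yi assms(1) by (simp add: X_def algebra_simps)
  then have "norm (ba_inverse y - X) \<le> norm (ba_inverse y) * norm (x - y) * norm X"
    by (metis (no_types) norm_mult_ineq mult_right_mono norm_ge_zero order_trans)
  also have "\<dots> \<le> (norm X * 2) * norm (x - y) * norm X"
    by (intro mult_right_mono nY) auto
  finally show "norm (ba_inverse y - ba_inverse x) \<le> 2 * norm (ba_inverse x) ^ 2 * norm (y - x)"
    by (simp add: X_def power2_eq_square norm_minus_commute mult_ac)
qed

lemma open_ba_invertible: "open {x :: 'a::{banach, real_normed_algebra_1}. ba_invertible x}"
proof (rule openI)
  fix x :: 'a assume "x \<in> {x. ba_invertible x}"
  then have x: "ba_invertible x" by simp
  define d where "d = 1 / (2 * (norm (ba_inverse x) + 1))"
  have n: "norm (ba_inverse x) + 1 > 0" by (rule add_nonneg_pos) auto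
  have "ball x d \<subseteq> {x. ba_invertible x}"
  proof
    fix y assume "y \<in> ball x d"
    then have "norm (y - x) \<le> d" by (simp add: dist_norm norm_minus_commute)
    then have "norm (y - x) * norm (ba_inverse x) \<le> d * (norm (ba_inverse x) + 1)"
      using n by (intro mult_mono) (auto simp: d_def)
    also have "\<dots> = 1 / 2" using n by (simp add: d_def field_simps)
    finally show "y \<in> {x. ba_invertible x}" using ba_inverse_perturb(1)[OF x] by simp
  qed
  moreover have "d > 0" using n by (simp add: d_def)
  ultimately show "\<exists>T>0. ball x T \<subseteq> {x. ba_invertible x}" by blast
qed

lemma tendsto_ba_inverse:
  fixes x :: "'a::{banach, real_normed_algebra_1}"
  assumes f: "(f \<longlongrightarrow> x) F" and x: "ba_invertible x"
  shows "((\<lambda>t. ba_inverse (f t)) \<longlongrightarrow> ba_inverse x) F"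
proof -
  have d: "((\<lambda>t. norm (f t - x)) \<longlongrightarrow> 0) F"
    using f by (simp add: LIM_zero tendsto_norm_zero)
  then have "((\<lambda>t. norm (f t - x) * norm (ba_inverse x)) \<longlongrightarrow> 0) F"
    by (rule tendsto_mult_left_zero)
  then have "\<forall>\<^sub>F t in F. norm (f t - x) * norm (ba_inverse x) < 1 / 2"
    by (rule order_tendstoD) simp
  then have "\<forall>\<^sub>F t in F. norm (ba_inverse (f t) - ba_inverse x)
      \<le> 2 * norm (ba_inverse x) ^ 2 * norm (f t - x)"
    by eventually_elim (use ba_inverse_perturb(2)[OF x] in auto)
  then have "((\<lambda>t. ba_inverse (f t) - ba_inverse x) \<longlongrightarrow> 0) F"
    by (rule Lim_null_comparison) (rule tendsto_mult_right_zero[OF d])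
  then show ?thesis by (simp add: LIM_zero_iff)
qed

lemma continuous_on_ba_inverse:
  fixes f :: "'b::topological_space \<Rightarrow> 'a::{banach, real_normed_algebra_1}"
  assumes "continuous_on S f" "\<And>t. t \<in> S \<Longrightarrow> ba_invertible (f t)"
  shows "continuous_on S (\<lambda>t. ba_inverse (f t))"
  using assms unfolding continuous_on_def by (blast intro: tendsto_ba_inverse)

subsection \<open>Polynomials and the spectrum\<close>

definition poly_ev :: "complex poly \<Rightarrow> 'a::complex_banach_algebra_1 \<Rightarrow> 'a" where
  "poly_ev p a = (\<Sum>i\<le>degree p. scaleC (coeff p i) (a ^ i))"

lemma poly_ev_altdef:
  assumes "degree p \<le> n"
  shows "poly_ev p a = (\<Sum>i\<le>n. scaleC (coeff p i) (a ^ i))"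
  unfolding poly_ev_def using assms
  by (intro sum.mono_neutral_left) (auto simp: coeff_eq_0)

lemma poly_ev_add: "poly_ev (p + q) a = poly_ev p a + poly_ev q a"
  using degree_add_le_max[of p q]
  by (simp add: poly_ev_altdef[of _ "max (degree p) (degree q)"] scaleC_add_left sum.distrib)

lemma poly_ev_smult: "poly_ev (smult c p) a = scaleC c (poly_ev p a)"
  using degree_smult_le[of c p]
  by (simp add: poly_ev_altdef[of _ "degree p"] scaleC.scale_sum_right scaleC_scaleC)

lemma poly_ev_diff: "poly_ev (p - q) a = poly_ev p a - poly_ev q a"
  using poly_ev_add[of "p - q" q a] by simp

lemma poly_ev_pCons: "poly_ev (pCons c p) a = scaleC c 1 + a * poly_ev p a"
  using degree_pCons_le[of c p]
  by (subst poly_ev_altdef[of _ "Suc (degree p)"])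
    (simp_all add: sum.atMost_Suc_shift poly_ev_def sum_distrib_left scaleC_mult_right del: sum.atMost_Suc)

lemma poly_ev_0 [simp]: "poly_ev 0 a = 0"
  by (simp add: poly_ev_def)

lemma poly_ev_linear_mult: "poly_ev ([:- z, 1:] * q) a = (a - scaleC z 1) * poly_ev q a"
  by (simp add: poly_ev_add poly_ev_diff poly_ev_smult poly_ev_pCons left_diff_distrib scaleC_1_mult)

lemma poly_ev_commute:
  assumes "a * y = y * a"
  shows "poly_ev p a * y = y * poly_ev p a"
proof (induction p)
  case (pCons c p)
  then show ?case using assms
    by (simp add: poly_ev_pCons distrib_left distrib_right scaleC_1_mult) (metis mult.assoc)
qed simp

text \<open>One half of the spectral mapping theorem: \<open>p\<close> splits into linear factors
  over the complex numbers, and each root contributes an invertible factor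
  \<open>a - scaleC z 1\<close>.\<close>

lemma poly_ev_invertible:
  assumes "p \<noteq> 0" "\<And>z. poly p z = 0 \<Longrightarrow> z \<notin> ba_spectrum a"
  shows "ba_invertible (poly_ev p a)"
  using assms
proof (induction "degree p" arbitrary: p)
  case 0
  then obtain c where "p = [:c:]" "c \<noteq> 0" by (metis degree_eq_zeroE pCons_eq_0_iff)
  then show ?case by (simp add: poly_ev_pCons ba_invertible_scaleC_iff)
next
  case (Suc n)
  then have "\<not> constant (poly p)" by (simp add: constant_degree)
  then obtain z where z: "poly p z = 0" using fundamental_theorem_of_algebra by blast
  then obtain q where q: "p = [:- z, 1:] * q" by (auto simp: poly_eq_0_iff_dvd)
  with Suc.prems(1) have "q \<noteq> 0" by auto
  then have "degree p = Suc (degree q)" unfolding q by (subst degree_mult_eq) auto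
  with Suc q \<open>q \<noteq> 0\<close> have "ba_invertible (poly_ev q a)" by (metis mult_zero_right nat.inject poly_mult)
  moreover have "ba_invertible (a - scaleC z 1)"
    using Suc.prems(2)[OF z] by (simp add: ba_spectrum_def)
  ultimately show ?case unfolding q poly_ev_linear_mult by (rule ba_invertible_mult[rotated])
qed

lemma poly_ev_monom: "poly_ev (monom 1 n) a = a ^ n"
  by (induction n) (simp_all add: monom_0 monom_Suc poly_ev_pCons scaleC_one)

subsection \<open>Dyadic averages of the resolvent\<close>

text \<open>Partial fractions: 2 / (1 - x^2) = 1 / (1 - x) + 1 / (1 + x) with x =
  \<open>scaleC v u\<close>.\<close>

lemma dyadic_resolvent_aux:
  fixes u :: "'a::complex_banach_algebra_1"
  assumes "ba_invertible (1 - scaleC v u)" "ba_invertible (1 - scaleC (- v) u)"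
  shows "ba_invertible (1 - scaleC (v\<^sup>2) (u\<^sup>2))"
    and "ba_inverse (1 - scaleC (v\<^sup>2) (u\<^sup>2)) =
      scaleR (1 / 2) (ba_inverse (1 - scaleC v u) + ba_inverse (1 - scaleC (- v) u))"
proof -
  define x where "x = scaleC v u"
  define f g where "f = ba_inverse (1 - x)" and "g = ba_inverse (1 + x)"
  have inv: "ba_invertible (1 - x)" "ba_invertible (1 + x)"
    using assms by (simp_all add: x_def)
  have sq: "scaleC (v\<^sup>2) (u\<^sup>2) = x\<^sup>2" by (simp add: x_def power_scaleC)
  have fac: "1 - x\<^sup>2 = (1 + x) * (1 - x)" "1 - x\<^sup>2 = (1 - x) * (1 + x)"
    by (simp_all add: algebra_simps power2_eq_square)
  have two: "(1 + x) + (1 - x) = scaleR 2 1" by (simp add: scaleR_2)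
  have "(1 - x\<^sup>2) * f = 1 + x" "(1 - x\<^sup>2) * g = 1 - x"
    by (simp add: fac(1) f_def inv mult.assoc, simp add: fac(2) g_def inv mult.assoc)
  then have 1: "(1 - x\<^sup>2) * scaleR (1 / 2) (f + g) = 1"
    by (simp add: distrib_left two del: add_diff_eq)
  have "f * (1 - x\<^sup>2) = 1 + x" "g * (1 - x\<^sup>2) = 1 - x"
    by (simp add: fac(2) f_def inv, simp add: fac(1) g_def inv)
  then have 2: "scaleR (1 / 2) (f + g) * (1 - x\<^sup>2) = 1"
    by (simp add: distrib_right two del: add_diff_eq)
  show "ba_invertible (1 - scaleC (v\<^sup>2) (u\<^sup>2))"
    unfolding sq by (rule ba_invertibleI[OF 1 2])
  show "ba_inverse (1 - scaleC (v\<^sup>2) (u\<^sup>2)) =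
      scaleR (1 / 2) (ba_inverse (1 - scaleC v u) + ba_inverse (1 - scaleC (- v) u))"
    unfolding sq using ba_inverse_eqI[OF 1 2] by (simp add: f_def g_def x_def)
qed

text \<open>When the inverses exist, this is the mean of \<open>ba_inverse (1 - scaleC v c)\<close>
  over all v with v^(2^i) = w. The point \<open>w\<close> stays variable because the recursion in
  \<open>i\<close> passes to its square roots, even though only the limit at \<open>w = 1\<close> is
  wanted.\<close>

definition dyadic_resolvent :: "'a::complex_banach_algebra_1 \<Rightarrow> nat \<Rightarrow> complex \<Rightarrow> 'a" where
  "dyadic_resolvent c i w = ba_inverse (1 - scaleC w (c ^ (2 ^ i)))"

text \<open>The spectrum of \<open>c\<close> misses the unit circle: 1 - w c = -w (c - 1/w), and
  inversion maps the circle to itself.\<close>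

definition circle_regular :: "'a::complex_banach_algebra_1 \<Rightarrow> bool" where
  "circle_regular c \<longleftrightarrow> (\<forall>w. cmod w = 1 \<longrightarrow> ba_invertible (1 - scaleC w c))"

lemma circle_regular_invertible:
  assumes "circle_regular c" "cmod w = 1"
  shows "ba_invertible (1 - scaleC w (c ^ (2 ^ i)))"
  using assms(2)
proof (induction i arbitrary: w)
  case 0
  then show ?case using assms(1) by (simp add: circle_regular_def)
next
  case (Suc i)
  then have "cmod (csqrt w) = 1" by (simp add: norm_csqrt)
  with dyadic_resolvent_aux(1)[of "csqrt w" "c ^ 2 ^ i"] Suc.IH[of "csqrt w"] Suc.IH[of "- csqrt w"]
  show ?case by (simp add: power_mult[symmetric] mult.commute)
qed

lemma dyadic_resolvent_Suc:
  assumes "circle_regular c" "cmod v = 1"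
  shows "dyadic_resolvent c (Suc i) (v\<^sup>2) =
    scaleR (1 / 2) (dyadic_resolvent c i v + dyadic_resolvent c i (- v))"
  using dyadic_resolvent_aux(2)[of v "c ^ 2 ^ i"] assms
  by (simp add: dyadic_resolvent_def circle_regular_invertible power_mult[symmetric] mult.commute
      del: scaleC.scale_minus_left)

lemma norm_mean_le:
  fixes x y :: "'a::real_normed_vector"
  assumes "norm x \<le> M" "norm y \<le> M"
  shows "norm (scaleR (1 / 2) (x + y)) \<le> M"
  using norm_triangle_ineq[of x y] assms by simp

lemma dyadic_resolvent_bound:
  assumes "circle_regular c" "\<And>w. cmod w = 1 \<Longrightarrow> norm (dyadic_resolvent c 0 w) \<le> M" "cmod w = 1"
  shows "norm (dyadic_resolvent c i w) \<le> M"
  using assms(3)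
proof (induction i arbitrary: w)
  case (Suc i)
  then have "cmod (csqrt w) = 1" by (simp add: norm_csqrt)
  then show ?case
    using dyadic_resolvent_Suc[OF assms(1), of "csqrt w" i] Suc.IH
      norm_mean_le[of "dyadic_resolvent c i (csqrt w)" M "dyadic_resolvent c i (- csqrt w)"] by simp
qed (use assms in auto)

text \<open>Both averages run over the same two square roots, so a bound at level 0 survives at
  every level. This makes the limit idempotent depend continuously on the element.\<close>

lemma dyadic_resolvent_diff_bound:
  assumes "circle_regular c" "circle_regular d"
    and "\<And>w. cmod w = 1 \<Longrightarrow> norm (dyadic_resolvent c 0 w - dyadic_resolvent d 0 w) \<le> M"
    and "cmod w = 1"
  shows "norm (dyadic_resolvent c i w - dyadic_resolvent d i w) \<le> M"
  using assms(4)
proof (induction i arbitrary: w)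
  case (Suc i)
  define v where "v = csqrt w"
  have v: "cmod v = 1" "w = v\<^sup>2" using Suc.prems by (simp_all add: v_def norm_csqrt)
  have "dyadic_resolvent c (Suc i) w - dyadic_resolvent d (Suc i) w = scaleR (1 / 2)
      ((dyadic_resolvent c i v - dyadic_resolvent d i v)
        + (dyadic_resolvent c i (- v) - dyadic_resolvent d i (- v)))"
    by (simp only: v(2) dyadic_resolvent_Suc[OF assms(1) v(1)] dyadic_resolvent_Suc[OF assms(2) v(1)])
      (simp add: algebra_simps)
  then show ?case by (metis norm_mean_le Suc.IH v(1) norm_minus_cancel)
qed (use assms in auto)

text \<open>By the parallelogram law the squared moduli of v + s and v - s add up to 4, so for one
  choice of sign the sum has modulus at least sqrt 2. Then divide w - w' = (v - v') (v +
  v').\<close>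

lemma square_roots_close:
  assumes "cmod w = 1" "cmod w' = 1"
  obtains v v' where "w = v\<^sup>2" "w' = v'\<^sup>2" "cmod v = 1" "cmod v' = 1"
    "cmod (v - v') \<le> cmod (w - w') / sqrt 2"
proof -
  define v s where "v = csqrt w" and "s = csqrt w'"
  have v: "cmod v = 1" "cmod s = 1" "v\<^sup>2 = w" "s\<^sup>2 = w'"
    using assms by (simp_all add: v_def s_def norm_csqrt)
  have "(cmod (v + s))\<^sup>2 + (cmod (v - s))\<^sup>2 = 2 * (cmod v)\<^sup>2 + 2 * (cmod s)\<^sup>2"
    unfolding cmod_power2 by (simp add: power2_eq_square algebra_simps)
  then have sum: "(cmod (v + s))\<^sup>2 + (cmod (v - s))\<^sup>2 = 4" by (simp add: v)
  have *: "\<exists>s'. s'\<^sup>2 = w' \<and> cmod s' = 1 \<and> 2 \<le> (cmod (v + s'))\<^sup>2"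
  proof (cases "2 \<le> (cmod (v + s))\<^sup>2")
    case True
    then show ?thesis using v by blast
  next
    case False
    then show ?thesis using v sum by (intro exI[of _ "- s"]) auto
  qed
  then obtain s' where s': "s'\<^sup>2 = w'" "cmod s' = 1" "2 \<le> (cmod (v + s'))\<^sup>2" by blast
  then have "sqrt 2 \<le> cmod (v + s')" by (simp add: real_le_lsqrt)
  moreover have "w - w' = (v - s') * (v + s')"
    by (simp add: v(3)[symmetric] s'(1)[symmetric] power2_eq_square algebra_simps)
  ultimately have "cmod (v - s') * sqrt 2 \<le> cmod (w - w')"
    by (simp add: norm_mult mult_left_mono)
  then show thesis using that[of v s'] v s' by (simp add: pos_le_divide_eq)
qed

text \<open>Averaging over both square roots shrinks the Lipschitz constant by \<open>sqrt 2\<close>, because the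
  roots of two points of the unit circle can be paired so that \<open>\<bar>v + v'\<bar> \<ge> sqrt 2\<close>.\<close>

lemma dyadic_resolvent_lipschitz:
  assumes "circle_regular c"
    and "\<And>w w'. cmod w = 1 \<Longrightarrow> cmod w' = 1 \<Longrightarrow>
      norm (dyadic_resolvent c 0 w - dyadic_resolvent c 0 w') \<le> L * cmod (w - w')"
    and "cmod w = 1" "cmod w' = 1" and "0 \<le> L"
  shows "norm (dyadic_resolvent c i w - dyadic_resolvent c i w') \<le> L * (1 / sqrt 2) ^ i * cmod (w - w')"
  using assms(3,4)
proof (induction i arbitrary: w w')
  case (Suc i)
  obtain v v' where v: "w = v\<^sup>2" "w' = v'\<^sup>2" "cmod v = 1" "cmod v' = 1"
    and close: "cmod (v - v') \<le> cmod (w - w') / sqrt 2"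
    using square_roots_close Suc.prems by blast
  let ?K = "L * (1 / sqrt 2) ^ i"
  have "dyadic_resolvent c (Suc i) w - dyadic_resolvent c (Suc i) w' = scaleR (1 / 2)
      ((dyadic_resolvent c i v - dyadic_resolvent c i v')
        + (dyadic_resolvent c i (- v) - dyadic_resolvent c i (- v')))"
    by (simp only: v(1,2) dyadic_resolvent_Suc[OF assms(1)] v(3,4)) (simp add: algebra_simps)
  moreover have "norm (dyadic_resolvent c i v - dyadic_resolvent c i v') \<le> ?K * cmod (v - v')"
    using Suc.IH v by simp
  moreover have "norm (dyadic_resolvent c i (- v) - dyadic_resolvent c i (- v')) \<le> ?K * cmod (v - v')"
    using Suc.IH[of "- v" "- v'"] v by (simp add: norm_minus_commute)
  ultimately have "norm (dyadic_resolvent c (Suc i) w - dyadic_resolvent c (Suc i) w')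
      \<le> ?K * cmod (v - v')"
    using norm_mean_le by metis
  also have "\<dots> \<le> ?K * (cmod (w - w') / sqrt 2)"
    using close \<open>0 \<le> L\<close> by (intro mult_left_mono) auto
  finally show ?case by simp
qed (use assms in auto)

section \<open>Convergence of the averages to an idempotent\<close>

lemma ba_inverse_diff:
  assumes "ba_invertible x" "ba_invertible y"
  shows "ba_inverse x - ba_inverse y = ba_inverse x * (y - x) * ba_inverse y"
  using assms by (simp add: algebra_simps)

lemma resolvent_diff_bound:
  fixes a :: "'a::complex_banach_algebra_1"
  assumes inv: "ba_invertible (1 - scaleC w a)" "ba_invertible (1 - scaleC w' a)"
    and "norm (ba_inverse (1 - scaleC w a)) \<le> M" "norm (ba_inverse (1 - scaleC w' a)) \<le> M"
  shows "norm (ba_inverse (1 - scaleC w a) - ba_inverse (1 - scaleC w' a)) \<le> M\<^sup>2 * norm a * cmod (w - w')"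
proof -
  define X Y where "X = ba_inverse (1 - scaleC w a)" and "Y = ba_inverse (1 - scaleC w' a)"
  have "X - Y = X * scaleC (w - w') a * Y"
    unfolding X_def Y_def ba_inverse_diff[OF inv] by (simp add: scaleC.scale_left_diff_distrib)
  then have "norm (X - Y) \<le> norm X * norm (scaleC (w - w') a) * norm Y"
    by (metis (no_types) norm_mult_ineq mult_right_mono norm_ge_zero order_trans)
  also have "\<dots> \<le> M * norm (scaleC (w - w') a) * M"
    using assms(3,4) by (intro mult_mono mult_nonneg_nonneg) (auto simp: X_def Y_def intro: order_trans[OF norm_ge_zero])
  finally show ?thesis by (simp add: X_def Y_def norm_scaleC power2_eq_square mult_ac)
qed

lemma circle_regular_bounded:
  assumes "circle_regular c"
  obtains M where "\<And>w. cmod w = 1 \<Longrightarrow> norm (dyadic_resolvent c 0 w) \<le> M"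
proof -
  have "continuous_on (sphere 0 1) (\<lambda>w. ba_inverse (1 - scaleC w c))"
    by (intro continuous_on_ba_inverse continuous_intros)
      (use assms in \<open>auto simp: circle_regular_def\<close>)
  then have "bounded ((\<lambda>w. ba_inverse (1 - scaleC w c)) ` sphere 0 1)"
    by (intro compact_imp_bounded compact_continuous_image) auto
  then show thesis using that by (force simp: bounded_iff dyadic_resolvent_def)
qed

text \<open>The points 1 and -1 are the square roots of 1, so one averaging step moves
  \<open>?f\<close> by half of \<open>?f i - ?g i\<close>, which the Lipschitz bound makes
  geometrically small. The limit is idempotent because (1 - u) f = 1 and g (1 + u) = 1 give f = g (2
  f - 1), so that f^2 - f is half of (f - g) (2 f - 1).\<close>

lemma circle_regular_idempotent:
  assumes c: "circle_regular (c :: 'a::complex_banach_algebra_1)"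
  obtains e where "(\<lambda>i. dyadic_resolvent c i 1) \<longlonglongrightarrow> e" "e * e = e"
proof -
  let ?f = "\<lambda>i. dyadic_resolvent c i 1" and ?g = "\<lambda>i. dyadic_resolvent c i (- 1)"
  obtain M where M: "\<And>w. cmod w = 1 \<Longrightarrow> norm (dyadic_resolvent c 0 w) \<le> M"
    using circle_regular_bounded[OF c] by blast
  define L where "L = M\<^sup>2 * norm c"
  have "norm (dyadic_resolvent c 0 w - dyadic_resolvent c 0 w') \<le> L * cmod (w - w')"
    if "cmod w = 1" "cmod w' = 1" for w w'
    using resolvent_diff_bound[of w c w' M] that M[of w] M[of w'] c
    by (simp add: dyadic_resolvent_def circle_regular_def L_def)
  then have "norm (?f i - ?g i) \<le> L * (1 / sqrt 2) ^ i * cmod (1 - (- 1))" for i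
    by (rule dyadic_resolvent_lipschitz[OF c]) (simp_all add: L_def)
  then have fg: "norm (?f i - ?g i) \<le> 2 * L * (1 / sqrt 2) ^ i" for i
    by (simp add: mult_ac)
  have sq2: "\<bar>1 / sqrt 2\<bar> < 1" by simp
  have diff: "?f (Suc i) - ?f i = - scaleR (1 / 2) (?f i - ?g i)" for i
  proof -
    have "scaleR (1 / 2) (x + y) - x = - scaleR (1 / 2) (x - y)" for x y :: 'a
    proof -
      have "x = scaleR (1 / 2) (x + x)" by (simp flip: scaleR_2)
      then have "scaleR (1 / 2) (x + y) - x = scaleR (1 / 2) (x + y) - scaleR (1 / 2) (x + x)" by simp
      also have "\<dots> = - scaleR (1 / 2) (x - y)"
        unfolding scaleR_right_diff_distrib[symmetric] scaleR_minus_right[symmetric] by simp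
      finally show ?thesis .
    qed
    then show ?thesis using dyadic_resolvent_Suc[OF c, of 1 i] by simp
  qed
  have "summable (\<lambda>i. ?f (Suc i) - ?f i)"
  proof (rule summable_comparison_test)
    show "summable (\<lambda>i. 2 * L * (1 / sqrt 2) ^ i)"
      using summable_geometric sq2 by (intro summable_mult) auto
    have "norm (?f (Suc n) - ?f n) \<le> norm (?f n - ?g n)" for n
      unfolding diff by simp
    then show "\<exists>N. \<forall>n\<ge>N. norm (?f (Suc n) - ?f n) \<le> 2 * L * (1 / sqrt 2) ^ n"
      using fg order_trans by blast
  qed
  then have "convergent (\<lambda>n. \<Sum>i<n. ?f (Suc i) - ?f i)"
    by (simp add: summable_iff_convergent)
  then have "convergent (\<lambda>n. (?f n - ?f 0) + ?f 0)"
    unfolding sum_lessThan_telescope[of ?f] by (intro convergent_add convergent_const)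
  then have "convergent ?f" by simp
  then obtain e where e: "?f \<longlonglongrightarrow> e" unfolding convergent_def by blast
  have "(\<lambda>i. 2 * L * (1 / sqrt 2) ^ i) \<longlonglongrightarrow> 2 * L * 0"
    by (intro tendsto_intros LIMSEQ_power_zero) (use sq2 in auto)
  then have lim0: "(\<lambda>i. 2 * L * (1 / sqrt 2) ^ i) \<longlonglongrightarrow> 0" by simp
  have fg0: "(\<lambda>i. ?f i - ?g i) \<longlonglongrightarrow> 0"
    by (rule Lim_null_comparison[OF always_eventually lim0]) (intro allI fg)
  have eq: "?f i * ?f i = ?f i + scaleR (1 / 2) ((?f i - ?g i) * (2 * ?f i - 1))" for i
  proof -
    define u f g where "u = c ^ 2 ^ i" and "f = ?f i" and "g = ?g i"
    have inv: "ba_invertible (1 - u)" "ba_invertible (1 + u)"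
      using circle_regular_invertible[OF c, of 1 i] circle_regular_invertible[OF c, of "- 1" i]
      by (simp_all add: u_def scaleC_one)
    have f: "(1 - u) * f = 1" and g: "g * (1 + u) = 1"
      using inv by (simp_all add: f_def g_def u_def dyadic_resolvent_def scaleC_one)
    from f have "(1 + u) * f = 2 * f - 1" by (simp add: left_diff_distrib distrib_right mult_2)
      (metis add.commute add_diff_cancel_right' diff_add_cancel add.assoc)
    with g have "f = g * (2 * f - 1)" by (metis mult.assoc mult_1_left)
    then have "(f - g) * (2 * f - 1) = f * (2 * f - 1) - f"
      unfolding left_diff_distrib by simp
    also have "\<dots> = scaleR 2 (f * f - f)"
      by (simp add: right_diff_distrib scaleR_2 mult_2 distrib_left)
    finally have "(f - g) * (2 * f - 1) = scaleR 2 (f * f - f)" .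
    then show ?thesis by (simp add: f_def g_def)
  qed
  have "(\<lambda>i. ?f i + scaleR (1 / 2) ((?f i - ?g i) * (2 * ?f i - 1))) \<longlonglongrightarrow> e + scaleR (1 / 2) (0 * (2 * e - 1))"
    by (intro tendsto_intros e fg0)
  then have "(\<lambda>i. ?f i * ?f i) \<longlonglongrightarrow> e" unfolding eq by simp
  moreover have "(\<lambda>i. ?f i * ?f i) \<longlonglongrightarrow> e * e" by (intro tendsto_intros e)
  ultimately have "e * e = e" by (rule LIMSEQ_unique[rotated])
  with e show thesis by (rule that)
qed

lemma dyadic_resolvent_commute:
  assumes "circle_regular c" "cmod w = 1" "c * y = y * c"
  shows "dyadic_resolvent c i w * y = y * dyadic_resolvent c i w"
  unfolding dyadic_resolvent_def
  using power_commuting_commutes[OF assms(3), of "2 ^ i"] circle_regular_invertible[OF assms(1,2), of i]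
  by (intro ba_inverse_commute)
    (auto simp: algebra_simps scaleC_mult_left scaleC_mult_right)

lemma tendsto_commute:
  fixes y :: "'a::real_normed_algebra"
  assumes "f \<longlonglongrightarrow> e" "\<And>i. f i * y = y * f i"
  shows "e * y = y * e"
proof (rule LIMSEQ_unique)
  show "(\<lambda>i. f i * y) \<longlonglongrightarrow> e * y" by (intro tendsto_intros assms)
  show "(\<lambda>i. f i * y) \<longlonglongrightarrow> y * e" unfolding assms(2) by (intro tendsto_intros assms)
qed

text \<open>The difference h satisfies h^3 = h, so its norm is at most its own cube. A path of
  commuting idempotents therefore cannot move in small steps.\<close>

lemma commuting_idempotents_eq:
  fixes e d :: "'a::real_normed_algebra_1"
  assumes "e * e = e" "d * d = d" "e * d = d * e" "norm (e - d) < 1"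
  shows "e = d"
proof -
  define h where "h = e - d"
  have ed: "e * (d * x) = d * (e * x)" "e * (e * x) = e * x" "d * (d * x) = d * x" for x
    by (metis assms mult.assoc)+
  have "h * h * h = h"
    by (simp add: h_def left_diff_distrib right_diff_distrib mult.assoc assms ed)
  then have "norm h \<le> norm h * norm h * norm h"
    by (metis norm_mult_ineq mult_right_mono norm_ge_zero order_trans)
  then have "norm h * 1 \<le> norm h * (norm h * norm h)" by (simp add: mult.assoc)
  moreover have "norm h * norm h < 1"
    using mult_strict_mono'[of "norm h" 1 "norm h" 1] assms(4) by (simp add: h_def)
  ultimately have "\<not> norm h > 0" using mult_le_cancel_left_pos[of "norm h" 1 "norm h * norm h"] by linarith
  then show ?thesis by (simp add: h_def)
qed

lemma circle_regular_commute_limit: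
  assumes "circle_regular c" "(\<lambda>i. dyadic_resolvent c i 1) \<longlonglongrightarrow> e" "c * y = y * c"
  shows "e * y = y * e"
proof (rule tendsto_commute[OF assms(2)])
  show "dyadic_resolvent c i 1 * y = y * dyadic_resolvent c i 1" for i
    by (rule dyadic_resolvent_commute[OF assms(1) _ assms(3)]) simp
qed

subsection \<open>Nonempty spectrum\<close>

text \<open>A homotopy replaces Liouville's theorem. With empty spectrum, every real multiple t a
  has a limit idempotent \<open>e t\<close>. These commute and are Lipschitz in t, so they keep the
  value 1 that they have at t = 0. For large t the resolvent is small on the whole circle, which
  forces \<open>norm (e t)\<close> down to 1/2.\<close>

theorem ba_spectrum_nonempty: "ba_spectrum (a :: 'a::complex_banach_algebra_1) \<noteq> {}"
proof
  assume "ba_spectrum a = {}"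
  then have all: "ba_invertible (a - scaleC z 1)" for z by (auto simp: ba_spectrum_def)
  from all[of 0] have a: "ba_invertible a" by simp
  define A where "A = ba_inverse a"
  have inv: "ba_invertible (1 - scaleC w a)" for w
  proof (cases "w = 0")
    case False
    then have "1 - scaleC w a = scaleC (- w) (a - scaleC (1 / w) 1)"
      by (simp add: scaleC.scale_right_diff_distrib scaleC_scaleC scaleC_one)
    with False show ?thesis by (simp add: ba_invertible_scaleC_iff all del: scaleC.scale_minus_left)
  qed simp
  let ?res = "\<lambda>w. ba_inverse (1 - scaleC w a)"
  \<comment> \<open>For |w| \<ge> R, 1 - w a = (1 - h) (-w a) with h = a^{-1} / w of norm at most
    1/2. The inverse then has norm at most 2 \<open>norm A\<close> / |w|, and the factor 4 makes
    this at most 1/2. The summand 1 keeps w away from 0 .\<close>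
  define R where "R = 4 * norm A + 1"
  have large: "norm (?res w) \<le> 1 / 2" if "R \<le> cmod w" for w
  proof -
    have w: "0 < cmod w" "4 * norm A \<le> cmod w"
      using that norm_ge_zero[of A] unfolding R_def by linarith+
    then have "w \<noteq> 0" by auto
    note w = this w
    define h where "h = scaleC (1 / w) A"
    have "norm h \<le> 1 / 2"
    proof -
      have "2 * norm A \<le> cmod w" using w norm_ge_zero[of A] by linarith
      then show ?thesis using w(1,2) by (simp add: h_def norm_scaleC norm_divide field_simps)
    qed
    then have hinv: "ba_invertible (1 - h)" and "norm (ba_inverse (1 - h)) \<le> 1 / (1 - norm h)"
      using neumann[of h] by auto
    then have hn: "norm (ba_inverse (1 - h)) \<le> 2"
      using \<open>norm h \<le> 1 / 2\<close> order_trans[of _ "1 / (1 - norm h)" 2] by (simp add: divide_simps)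
    have fac: "1 - scaleC w a = (1 - h) * scaleC (- w) a" "scaleC (- w) a * scaleC (- (1 / w)) A = 1"
        "scaleC (- (1 / w)) A * scaleC (- w) a = 1"
      using w(1) a by (simp_all add: h_def A_def left_diff_distrib scaleC_mult_left scaleC_mult_right
          scaleC.scale_right_diff_distrib scaleC_scaleC scaleC_one)
    have "?res w = scaleC (- (1 / w)) A * ba_inverse (1 - h)"
    proof (rule ba_inverse_eqI)
      show "(1 - scaleC w a) * (scaleC (- (1 / w)) A * ba_inverse (1 - h)) = 1"
        by (metis fac(1,2) hinv ba_inverse_right mult.assoc mult_1_left)
      show "scaleC (- (1 / w)) A * ba_inverse (1 - h) * (1 - scaleC w a) = 1"
        by (metis fac(1,3) hinv ba_inverse_left mult.assoc mult_1_left)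
    qed
    then have "norm (?res w) \<le> norm (scaleC (- (1 / w)) A) * norm (ba_inverse (1 - h))"
      by (simp only: norm_mult_ineq)
    also have "\<dots> \<le> norm (scaleC (- (1 / w)) A) * 2" by (rule mult_left_mono[OF hn norm_ge_zero])
    also have "\<dots> \<le> 1 / 2" using w by (simp add: norm_scaleC norm_divide field_simps)
    finally show ?thesis .
  qed
  have "continuous_on (cball 0 R) ?res"
    by (intro continuous_on_ba_inverse continuous_intros inv)
  then have "bounded (?res ` cball 0 R)"
    by (intro compact_imp_bounded compact_continuous_image) auto
  then obtain M0 where M0: "\<And>w. w \<in> cball 0 R \<Longrightarrow> norm (?res w) \<le> M0"
    unfolding bounded_iff by blast
  define M where "M = max M0 (1 / 2)"
  have M: "norm (?res w) \<le> M" for w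
    using M0[of w] large[of w] by (cases "R \<le> cmod w") (auto simp: M_def)
  define L where "L = M\<^sup>2 * norm a"
  have L: "0 \<le> L" by (simp add: L_def)
  define c where "c t = scaleC (complex_of_real t) a" for t :: real
  have c: "circle_regular (c t)" for t
    using inv by (simp add: circle_regular_def c_def scaleC_scaleC)
  have res: "dyadic_resolvent (c t) 0 w = ?res (w * complex_of_real t)" for t w
    by (simp add: dyadic_resolvent_def c_def scaleC_scaleC)
  have "\<exists>e. (\<lambda>i. dyadic_resolvent (c t) i 1) \<longlonglongrightarrow> e \<and> e * e = e" for t
    using circle_regular_idempotent[OF c] by metis
  then obtain e where e: "\<And>t. (\<lambda>i. dyadic_resolvent (c t) i 1) \<longlonglongrightarrow> e t" "\<And>t. e t * e t = e t"
    by metis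
  have "e t * a = a * e t" for t
    by (rule circle_regular_commute_limit[OF c e(1)]) (simp add: c_def scaleC_mult_left scaleC_mult_right)
  then have comm: "e t * e s = e s * e t" for t s
    by (intro circle_regular_commute_limit[OF c e(1)]) (simp add: c_def scaleC_mult_left scaleC_mult_right)
  have lip: "norm (e t - e s) \<le> L * \<bar>t - s\<bar>" for t s
  proof (rule Lim_bounded)
    show "(\<lambda>i. norm (dyadic_resolvent (c t) i 1 - dyadic_resolvent (c s) i 1)) \<longlonglongrightarrow> norm (e t - e s)"
      by (intro tendsto_intros e)
    have "norm (dyadic_resolvent (c t) 0 w - dyadic_resolvent (c s) 0 w) \<le> L * \<bar>t - s\<bar>"
      if "cmod w = 1" for w
    proof -
      have "cmod (w * complex_of_real t - w * complex_of_real s) = \<bar>t - s\<bar>"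
        using that by (simp flip: right_diff_distrib of_real_diff add: norm_mult)
      then show ?thesis
        using resolvent_diff_bound[OF inv inv M M, of "w * complex_of_real t" "w * complex_of_real s"]
        by (simp add: res L_def)
    qed
    then show "\<forall>i\<ge>0. norm (dyadic_resolvent (c t) i 1 - dyadic_resolvent (c s) i 1) \<le> L * \<bar>t - s\<bar>"
      by (auto intro: dyadic_resolvent_diff_bound[OF c c])
  qed
  \<comment> \<open>Chosen so that idempotents at distance \<open>\<delta>\<close> along the path
    differ by norm less than 1.\<close>
  define \<delta> where "\<delta> = 1 / (L + 1)"
  have "L * \<delta> < 1" "0 < \<delta>" using L by (simp_all add: \<delta>_def)
  have one: "e (real n * \<delta>) = 1" for n
  proof (induction n)
    case 0
    have "(\<lambda>i. dyadic_resolvent (c 0) i 1) = (\<lambda>i. 1)"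
      by (simp add: dyadic_resolvent_def c_def zero_power)
    with e(1)[of 0] show ?case by (simp add: LIMSEQ_const_iff)
  next
    case (Suc n)
    have "norm (e (real (Suc n) * \<delta>) - e (real n * \<delta>)) \<le> L * \<delta>"
      using lip[of "real (Suc n) * \<delta>" "real n * \<delta>"] \<open>0 < \<delta>\<close> by (simp add: algebra_simps)
    with \<open>L * \<delta> < 1\<close> have "e (real (Suc n) * \<delta>) = e (real n * \<delta>)"
      by (intro commuting_idempotents_eq[OF e(2) e(2) comm]) linarith
    with Suc show ?case by simp
  qed
  obtain n where "R / \<delta> \<le> real n" using real_arch_simple by blast
  then have n: "R \<le> real n * \<delta>" using \<open>0 < \<delta>\<close> by (simp add: pos_divide_le_eq)
  have "norm (e (real n * \<delta>)) \<le> 1 / 2"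
  proof (rule Lim_bounded)
    show "(\<lambda>i. norm (dyadic_resolvent (c (real n * \<delta>)) i 1)) \<longlonglongrightarrow> norm (e (real n * \<delta>))"
      by (intro tendsto_intros e)
    have "norm (dyadic_resolvent (c (real n * \<delta>)) 0 w) \<le> 1 / 2" if "cmod w = 1" for w
      unfolding res by (rule large) (use that n \<open>0 < \<delta>\<close> in \<open>simp add: norm_mult\<close>)
    from dyadic_resolvent_bound[OF c this]
    show "\<forall>i\<ge>0. norm (dyadic_resolvent (c (real n * \<delta>)) i 1) \<le> 1 / 2"
      by (metis norm_one)
  qed
  with one show False by simp
qed

text \<open>Nonemptiness of the spectrum is what puts 0 into it once all other points are
  excluded.\<close>

lemma quasinilpotent_iff: "quasinilpotent x \<longleftrightarrow> (\<forall>z. z \<noteq> 0 \<longrightarrow> ba_invertible (x - scaleC z 1))"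
proof -
  obtain t where "t \<in> ba_spectrum x" using ba_spectrum_nonempty[of x] by auto
  then have "ba_spectrum x = {0} \<longleftrightarrow> (\<forall>z. z \<noteq> 0 \<longrightarrow> z \<notin> ba_spectrum x)"
    by (cases "t = 0") auto
  then show ?thesis by (simp add: quasinilpotent_def) (simp add: ba_spectrum_def)
qed

subsection \<open>Riesz projections\<close>

text \<open>Factor 1 - y^2 = (1 - y) (1 + y) repeatedly. With the Neumann series, one small power of
  x then makes 1 - x invertible, in place of the spectral radius formula.\<close>

lemma ba_invertible_one_minus_dyadic_power:
  assumes "ba_invertible (1 - x ^ (2 ^ i))"
  shows "ba_invertible (1 - x)"
  using assms
proof (induction i)
  case (Suc i)
  define y where "y = x ^ (2 ^ i)"
  have sq: "x ^ (2 ^ Suc i) = y * y" by (simp add: y_def flip: power_add mult_2)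
  have "ba_invertible ((1 - y) * (1 + y))"
    using Suc.prems unfolding sq by (simp add: algebra_simps)
  then have "ba_invertible (1 - y)" by (rule ba_invertible_factor) (simp add: algebra_simps)
  then show ?case using Suc.IH by (simp add: y_def)
qed simp

lemma power_idempotent_mult:
  fixes a e :: "'a::ring_1"
  assumes "e * e = e" "a * e = e * a" "0 < n"
  shows "(e * a) ^ n = e * a ^ n"
  using assms(3)
proof (induction n rule: nat_induct_non_zero)
  case (Suc n)
  have "(e * a) ^ Suc n = e * (a * e) * a ^ n" by (simp add: Suc mult.assoc)
  also have "\<dots> = (e * e) * a ^ Suc n" by (simp add: assms(2) mult.assoc)
  finally show ?case by (simp add: assms(1))
qed simp

text \<open>Here \<open>e\<close> is the Riesz projection of \<open>a\<close> for the disc \<open>\<bar>z\<bar> < r\<close>, and \<open>x\<close> is the inverse of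
  \<open>a\<close> on the complementary corner.\<close>

lemma spectral_idempotent:
  fixes a :: "'a::complex_banach_algebra_1"
  assumes "0 < r" and circle: "\<And>z. cmod z = r \<Longrightarrow> z \<notin> ba_spectrum a"
  obtains e x where "e * e = e" "a * e = e * a" "a * x = x * a" "a * x = 1 - e" "x * e = 0"
    "\<And>z. r \<le> cmod z \<Longrightarrow> ba_invertible (e * a - scaleC z 1)"
proof -
  define c where "c = scaleC (1 / complex_of_real r) a"
  have c: "circle_regular c"
    unfolding circle_regular_def
  proof (intro allI impI)
    fix w :: complex assume w: "cmod w = 1"
    then have nz: "w \<noteq> 0" by auto
    have "1 - scaleC w c = scaleC (- (w / r)) (a - scaleC (r / w) 1)"
      using \<open>0 < r\<close> nz
      by (simp add: c_def scaleC.scale_right_diff_distrib scaleC_scaleC scaleC_one)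
    moreover have "ba_invertible (a - scaleC (r / w) 1)"
      using circle[of "r / w"] w \<open>0 < r\<close> by (simp add: ba_spectrum_def norm_divide)
    ultimately show "ba_invertible (1 - scaleC w c)"
      using \<open>0 < r\<close> nz by (simp add: ba_invertible_scaleC_iff del: scaleC.scale_minus_left)
  qed
  define f where "f i = dyadic_resolvent c i 1" for i
  define u where "u i = c ^ (2 ^ i)" for i :: nat
  obtain e where lim: "f \<longlonglongrightarrow> e" and ee: "e * e = e"
    using circle_regular_idempotent[OF c] unfolding f_def by blast
  have inv: "ba_invertible (1 - u i)" for i
    using circle_regular_invertible[OF c, of 1 i] by (simp add: u_def scaleC_one)
  have f: "f i * (1 - u i) = 1" "(1 - u i) * f i = 1" for i
    using inv by (simp_all add: f_def u_def dyadic_resolvent_def scaleC_one)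
  have ca: "c * a = a * c" by (simp add: c_def scaleC_mult_left scaleC_mult_right)
  have fa: "f i * a = a * f i" for i
    unfolding f_def by (rule dyadic_resolvent_commute[OF c _ ca]) simp
  have ea: "e * a = a * e" by (rule tendsto_commute[OF lim fa])
  then have ec: "e * c = c * e" by (simp add: c_def scaleC_mult_left scaleC_mult_right)
  have fe: "f i * e = e * f i" for i
    unfolding f_def by (rule dyadic_resolvent_commute[OF c _ ec[symmetric]]) simp
  have dist0: "(\<lambda>i. e - f i) \<longlonglongrightarrow> 0" using tendsto_diff[OF tendsto_const lim, of e] by simp
  then have "\<forall>\<^sub>F i in sequentially. norm (e - f i) < 1"
    by (intro order_tendstoD(2)[OF tendsto_norm_zero]) auto
  then obtain i where i: "norm (e - f i) < 1" by (auto simp: eventually_sequentially)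
  define d where "d = f i - e"
  have dinv: "ba_invertible (1 - d)"
    using i by (intro neumann) (simp add: d_def norm_minus_commute)
  \<comment> \<open>Splitting one factor \<open>c\<close> off \<open>u i\<close> in
    \<open>u i * f i = f i - 1\<close> gives \<open>a * y = 1 - f i\<close>. In the corner of
    \<open>1 - e\<close> this equals \<open>1 - d\<close>, so multiplying by the inverse of
    \<open>1 - d\<close> turns \<open>y\<close> into an exact inverse of \<open>a\<close>
    there.\<close>
  define y where "y = scaleC (- (1 / complex_of_real r)) (c ^ (2 ^ i - 1) * f i)"
  have "u i = c * c ^ (2 ^ i - 1)"
    by (simp add: u_def flip: power_Suc)
  then have "a * y = - (u i * f i)"
    by (simp add: y_def c_def scaleC_mult_left scaleC_mult_right mult.assoc)
  also have "\<dots> = 1 - f i" using f(2)[of i] by (simp add: algebra_simps)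
  finally have ay: "a * y = 1 - f i" .
  have cpa: "c ^ n * a = a * c ^ n" for n by (rule power_commuting_commutes[OF ca])
  have "c ^ n * f i * a = a * (c ^ n * f i)" for n
    by (metis fa cpa mult.assoc)
  then have ya: "y * a = a * y" by (simp add: y_def scaleC_mult_left scaleC_mult_right)
  have cpe: "c ^ n * e = e * c ^ n" for n by (rule power_commuting_commutes[OF ec[symmetric]])
  have "c ^ n * f i * e = e * (c ^ n * f i)" for n
    by (metis fe cpe mult.assoc)
  then have ye: "y * e = e * y" by (simp add: y_def scaleC_mult_left scaleC_mult_right)
  define D where "D = ba_inverse (1 - d)"
  have Da: "D * a = a * D"
    unfolding D_def using dinv by (rule ba_inverse_commute) (simp add: d_def algebra_simps fa ea)
  have De: "D * e = e * D"
    unfolding D_def using dinv by (rule ba_inverse_commute) (simp add: d_def algebra_simps fe)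
  define x where "x = y * (1 - e) * D"
  have pd: "(1 - e) * (1 - d) = (1 - f i) * (1 - e)"
    by (simp add: d_def algebra_simps ee fe)
  have "a * x = (1 - f i) * (1 - e) * D" by (simp add: x_def ay flip: mult.assoc)
  also have "\<dots> = 1 - e"
    using dinv by (simp add: D_def mult.assoc flip: pd)
  finally have ax: "a * x = 1 - e" .
  have xa: "a * x = x * a"
  proof -
    have "(1 - e) * a = a * (1 - e)" by (simp add: algebra_simps ea)
    then have "x * a = y * (a * (1 - e)) * D"
      unfolding x_def mult.assoc Da by (simp only: mult.assoc[symmetric])
    then show ?thesis by (simp only: x_def ya mult.assoc[symmetric])
  qed
  have "x * e = y * ((1 - e) * e) * D" by (simp only: x_def mult.assoc De)
  then have xe: "x * e = 0" by (simp add: left_diff_distrib ee)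
  \<comment> \<open>In the corner of \<open>e\<close>, \<open>f i\<close> agrees with k =
    \<open>1 - (e - f i)\<close>, which tends to 1. Hence
    \<open>e * (1 - u i) = e * ba_inverse k\<close> tends to \<open>e\<close>.\<close>
  have small: "(\<lambda>i. e * u i) \<longlonglongrightarrow> 0"
  proof -
    have "\<forall>\<^sub>F i in sequentially. norm (e - f i) < 1"
      using dist0 by (intro order_tendstoD(2)[OF tendsto_norm_zero]) auto
    then have "\<forall>\<^sub>F i in sequentially. e * (1 - ba_inverse (1 - (e - f i))) = e * u i"
    proof eventually_elim
      case (elim i)
      define k where "k = 1 - (e - f i)"
      have k: "ba_invertible k" unfolding k_def using elim by (rule neumann)
      have ke: "k * e = e * k" by (simp add: k_def algebra_simps fe)
      have "e * k * (1 - u i) = e * f i * (1 - u i)"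
        by (simp add: k_def distrib_left right_diff_distrib ee)
      also have "\<dots> = e" by (simp add: mult.assoc f)
      finally have "e = k * (e * (1 - u i))" by (simp add: ke flip: mult.assoc)
      then have "ba_inverse k * e = e * (1 - u i)" using ba_inverse_left'[OF k] by metis
      then have "e * ba_inverse k = e * (1 - u i)" using ba_inverse_commute[OF k ke] by simp
      then show ?case by (simp add: right_diff_distrib k_def)
    qed
    moreover have "(\<lambda>i. e * (1 - ba_inverse (1 - (e - f i)))) \<longlonglongrightarrow> e * (1 - ba_inverse (1 - 0))"
      by (intro tendsto_intros tendsto_ba_inverse dist0) simp
    ultimately show ?thesis by (simp add: filterlim_cong)
  qed
  \<comment> \<open>The 2^i-th power of e a / z is (r / z)^(2^i) times \<open>e * u i\<close>, and
    |r / z| \<le> 1, so some such power has norm below 1.\<close>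
  have outside: "ba_invertible (e * a - scaleC z 1)" if z: "r \<le> cmod z" for z
  proof -
    have znz: "z \<noteq> 0" using z \<open>0 < r\<close> by auto
    have "\<forall>\<^sub>F i in sequentially. norm (e * u i) < 1"
      using small by (intro order_tendstoD(2)[OF tendsto_norm_zero]) auto
    then obtain i where i: "norm (e * u i) < 1" by (auto simp: eventually_sequentially)
    define w where "w = scaleC (1 / z) (e * a)"
    have "(e * a) ^ (2 ^ i) = e * a ^ (2 ^ i)"
      by (rule power_idempotent_mult[OF ee ea[symmetric]]) simp
    then have "w ^ (2 ^ i) = scaleC ((r / z) ^ (2 ^ i)) (e * u i)"
      using \<open>0 < r\<close>
      by (simp add: w_def u_def c_def power_scaleC scaleC_mult_right scaleC_scaleC power_divide)
    then have "norm (w ^ (2 ^ i)) = (r / cmod z) ^ (2 ^ i) * norm (e * u i)"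
      using \<open>0 < r\<close> by (simp add: norm_scaleC norm_power norm_divide)
    also have "\<dots> \<le> 1 * norm (e * u i)"
      using z znz \<open>0 < r\<close> by (intro mult_right_mono power_le_one) auto
    finally have "ba_invertible (1 - w ^ (2 ^ i))" using i by (intro neumann) simp
    then have "ba_invertible (1 - w)" by (rule ba_invertible_one_minus_dyadic_power)
    moreover have "e * a - scaleC z 1 = scaleC (- z) (1 - w)"
      using znz by (simp add: w_def scaleC.scale_right_diff_distrib scaleC_scaleC scaleC_one)
    ultimately show ?thesis using znz by (simp add: ba_invertible_scaleC_iff del: scaleC.scale_minus_left)
  qed
  show thesis by (rule that[OF ee ea[symmetric] xa ax xe outside])
qed

text \<open>The elements \<open>u\<close> and \<open>v\<close> stand in for \<open>y * s\<close> and
  \<open>y\<close> in the two corners, and p s u^{-1} + (1 - p) v^{-1} glues their inverses. It is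
  two-sided because every piece commutes with \<open>y\<close>. The factor \<open>s\<close> allows
  for a corner where an inverse is known only for a multiple of \<open>y\<close>.\<close>

lemma ba_invertible_corners:
  assumes p: "p * p = p" "y * p = p * y"
    and u: "ba_invertible u" "p * u = p * (y * s)" "u * y = y * u" "s * y = y * s"
    and v: "ba_invertible v" "(1 - p) * v = (1 - p) * y" "v * y = y * v"
  shows "ba_invertible y"
proof (rule ba_invertibleI)
  let ?r = "p * (s * ba_inverse u) + (1 - p) * ba_inverse v"
  have U: "ba_inverse u * y = y * ba_inverse u" and V: "ba_inverse v * y = y * ba_inverse v"
    using u v by (simp_all add: ba_inverse_commute)
  have q: "y * (1 - p) = (1 - p) * y" by (simp add: algebra_simps p(2))
  have "y * ?r = p * (y * s) * ba_inverse u + (1 - p) * y * ba_inverse v"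
    by (simp only: distrib_left mult.assoc[symmetric] p(2) q)
  also have "\<dots> = p + (1 - p)" by (simp add: u(1) v(1) mult.assoc flip: u(2) v(2))
  finally show 1: "y * ?r = 1" by simp
  have "?r * y = y * ?r"
    unfolding distrib_left distrib_right by (metis U V q p(2) u(4) mult.assoc)
  with 1 show "?r * y = 1" by simp
qed

section \<open>Spectral criterion for g-pi-Hirano invertibility\<close>

lemma gpi_Hirano_iff_spectrum:
  "gpi_Hirano_invertible a \<longleftrightarrow> (\<exists>n>0. \<forall>z\<in>ba_spectrum a. z ^ (n + 1) = z)"
proof
  assume "gpi_Hirano_invertible a"
  then obtain x n where x: "x * a * x = x" "a * x = x * a" and "n > 0"
    and qn: "quasinilpotent (a - a ^ (n + 2) * x)"
    unfolding gpi_Hirano_invertible_def by blast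
  define p q where "p = a * x" and "q = a - a ^ (n + 2) * x"
  have pp: "p * p = p" by (metis p_def x mult.assoc)
  have ap: "a * p = p * a" by (metis p_def x(2) mult.assoc)
  \<comment> \<open>Thus \<open>q\<close> acts as a - a^(n+1) in the corner of \<open>p\<close> and
    as \<open>a\<close> in the corner of \<open>1 - p\<close>.\<close>
  have q: "q = a - a ^ (n + 1) * p"
    by (simp add: q_def p_def power_commutes mult.assoc) (metis mult.assoc power_commutes)
  have anp: "a ^ (n + 1) * p = p * a ^ (n + 1)" by (rule power_commuting_commutes[OF ap])
  have qa: "q * a = a * q"
    unfolding q by (simp add: left_diff_distrib right_diff_distrib)
      (metis ap mult.assoc power_commutes)
  have "ba_invertible (a - scaleC z 1)" if "z ^ (n + 1) \<noteq> z" for z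
  proof -
    define w where "w = z - z ^ (n + 1)"
    have "z \<noteq> 0" "w \<noteq> 0" using that by (auto simp: w_def)
    \<comment> \<open>The polynomial t - t^(n+1) - w vanishes at t = z, so a - z divides a - a^(n+1)
      - w. In the corner of \<open>p\<close> the latter is \<open>q - w\<close>, invertible since w
      is nonzero; the cofactor \<open>g\<close> plays the role of \<open>s\<close>.\<close>
    define P where "P = [:0, 1:] - monom 1 (n + 1) - [:w:]"
    have "poly P z = 0" by (simp add: P_def w_def poly_monom)
    then obtain Q where Q: "P = [:- z, 1:] * Q" by (auto simp: poly_eq_0_iff_dvd)
    define g where "g = poly_ev Q a"
    have "poly_ev P a = a - a ^ (n + 1) - scaleC w 1"
      by (simp add: P_def poly_ev_diff poly_ev_pCons poly_ev_monom scaleC_one del: power_Suc)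
    then have g: "(a - scaleC z 1) * g = a - a ^ (n + 1) - scaleC w 1"
      by (simp only: Q poly_ev_linear_mult g_def)
    have ga: "g * a = a * g" unfolding g_def by (rule poly_ev_commute) simp
    show ?thesis
    proof (rule ba_invertible_corners[OF pp])
      show "ba_invertible (q - scaleC w 1)" "ba_invertible (q - scaleC z 1)"
        using qn \<open>z \<noteq> 0\<close> \<open>w \<noteq> 0\<close> unfolding quasinilpotent_iff q_def by auto
      show "p * (q - scaleC w 1) = p * ((a - scaleC z 1) * g)"
        unfolding g q anp by (simp add: right_diff_distrib pp flip: mult.assoc)
      show "(1 - p) * (q - scaleC z 1) = (1 - p) * (a - scaleC z 1)"
        unfolding q anp by (simp add: right_diff_distrib left_diff_distrib pp flip: mult.assoc)
    qed (simp_all add: right_diff_distrib left_diff_distrib scaleC_1_mult ap ga qa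
        scaleC.scale_right_diff_distrib scaleC_scaleC mult.commute[of w z])
  qed
  then have "\<forall>z\<in>ba_spectrum a. z ^ (n + 1) = z" by (auto simp: ba_spectrum_def)
  with \<open>n > 0\<close> show "\<exists>n>0. \<forall>z\<in>ba_spectrum a. z ^ (n + 1) = z" by blast
next
  assume "\<exists>n>0. \<forall>z\<in>ba_spectrum a. z ^ (n + 1) = z"
  then obtain n where "n > 0" and spec: "\<And>z. z \<in> ba_spectrum a \<Longrightarrow> z ^ (n + 1) = z" by blast
  have norm1: "cmod z = 1" if "z \<in> ba_spectrum a" "z \<noteq> 0" for z
  proof -
    have "z ^ n = 1" using spec[OF that(1)] that(2) by simp
    then have "cmod z ^ n = 1" by (simp flip: norm_power)
    then show ?thesis using \<open>n > 0\<close> power_eq_imp_eq_base[of "cmod z" n 1] by simp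
  qed
  obtain e x where ee: "e * e = e" and ae: "a * e = e * a" and ax: "a * x = x * a"
    and axe: "a * x = 1 - e" and xe: "x * e = 0"
    and out: "\<And>z. 1 / 2 \<le> cmod z \<Longrightarrow> ba_invertible (e * a - scaleC z 1)"
  proof (rule spectral_idempotent[of "1 / 2" a])
    show "z \<notin> ba_spectrum a" if "cmod z = 1 / 2" for z using norm1[of z] that by (cases "z = 0") auto
  qed auto
  define p where "p = 1 - e"
  have pp: "p * p = p" and pe: "p * e = 0" "1 - p = e" by (simp_all add: p_def algebra_simps ee)
  have ap: "a * p = p * a" by (simp add: p_def algebra_simps ae)
  \<comment> \<open>For small nonzero z, e a - z agrees with the invertible a - z in the corner of
    \<open>e\<close> and with -z in the other corner.\<close>
  have corner: "ba_invertible (e * a - scaleC z 1)" if "z \<noteq> 0" for z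
  proof (cases "1 / 2 \<le> cmod z")
    case False
    have "z \<notin> ba_spectrum a" using norm1[of z] that False by auto
    then have az: "ba_invertible (a - scaleC z 1)" by (simp add: ba_spectrum_def)
    show ?thesis
    proof (rule ba_invertible_corners[OF ee, where u = "a - scaleC z 1" and v = "scaleC (- z) 1" and s = 1])
      show "ba_invertible (scaleC (- z) (1 :: 'a))"
        using that by (simp add: ba_invertible_scaleC_iff del: scaleC.scale_minus_left)
      show "e * (a - scaleC z 1) = e * ((e * a - scaleC z 1) * 1)"
        by (simp add: right_diff_distrib ee flip: mult.assoc)
      show "(1 - e) * scaleC (- z) 1 = (1 - e) * (e * a - scaleC z 1)"
        by (simp add: right_diff_distrib left_diff_distrib ee scaleC_1_mult flip: mult.assoc)
      show "(a - scaleC z 1) * (e * a - scaleC z 1) = (e * a - scaleC z 1) * (a - scaleC z 1)"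
        by (simp add: right_diff_distrib left_diff_distrib scaleC_1_mult
            scaleC.scale_right_diff_distrib) (metis ae mult.assoc)
      have "e * a * e = e * (e * a)" by (simp only: mult.assoc ae)
      then show "(e * a - scaleC z 1) * e = e * (e * a - scaleC z 1)"
        by (simp only: left_diff_distrib right_diff_distrib scaleC_1_mult)
      show "scaleC (- z) 1 * (e * a - scaleC z 1) = (e * a - scaleC z 1) * scaleC (- z) 1"
        by (simp only: scaleC_1_mult)
    qed (simp_all add: az)
  qed (use out in auto)
  define h where "h = a - a ^ (n + 1)"
  have anp: "a ^ (n + 1) * p = p * a ^ (n + 1)" by (rule power_commuting_commutes[OF ap])
  \<comment> \<open>On the spectrum t - t^(n+1) = 0, so t - t^(n+1) - z takes the value -z there and
    has no root in it.\<close>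
  have hinv: "ba_invertible (h - scaleC z 1)" if "z \<noteq> 0" for z
  proof -
    define P where "P = [:0, 1:] - monom 1 (n + 1) - [:z:]"
    have "poly_ev P a = h - scaleC z 1"
      by (simp add: h_def P_def poly_ev_diff poly_ev_pCons poly_ev_monom scaleC_one del: power_Suc)
    moreover have "poly P 0 \<noteq> 0" using that by (simp add: P_def poly_monom)
    then have "P \<noteq> 0" by auto
    moreover have "t \<notin> ba_spectrum a" if "poly P t = 0" for t
      using spec[of t] that \<open>z \<noteq> 0\<close> by (auto simp: P_def poly_monom)
    ultimately show ?thesis using poly_ev_invertible[of P a] by simp
  qed
  \<comment> \<open>Agrees with \<open>h\<close> in the corner of \<open>p\<close> and with
    \<open>e * a\<close> in the corner of \<open>e\<close>.\<close>
  define y where "y = a - a ^ (n + 1) * p"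
  have "a ^ (n + 1) * p * a = a * (a ^ (n + 1) * p)"
    unfolding mult.assoc ap[symmetric] by (simp only: mult.assoc[symmetric] power_commutes)
  then have ya: "y * a = a * y"
    by (simp only: y_def left_diff_distrib right_diff_distrib)
  have "a ^ (n + 1) * p * p = p * (a ^ (n + 1) * p)"
    unfolding mult.assoc[symmetric] anp[symmetric] ..
  then have yp: "y * p = p * y"
    by (simp only: y_def left_diff_distrib right_diff_distrib ap)
  have yh: "h * y = y * h"
    using power_commuting_commutes[OF ya[symmetric], of "n + 1"] ya
    by (simp add: h_def left_diff_distrib right_diff_distrib)
  have "y * e = e * y" using yp by (simp add: p_def algebra_simps)
  then have yea: "e * a * y = y * (e * a)" by (metis ya mult.assoc)
  have "quasinilpotent y"
    unfolding quasinilpotent_iff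
  proof (intro allI impI)
    fix z :: complex assume "z \<noteq> 0"
    show "ba_invertible (y - scaleC z 1)"
    proof (rule ba_invertible_corners[OF pp, where s = 1])
      show "ba_invertible (h - scaleC z 1)" "ba_invertible (e * a - scaleC z 1)"
        using \<open>z \<noteq> 0\<close> hinv corner by auto
      show "p * (h - scaleC z 1) = p * ((y - scaleC z 1) * 1)"
        unfolding y_def h_def anp by (simp add: right_diff_distrib pp flip: mult.assoc)
      have "e * (e * a - scaleC z 1) = e * (y - scaleC z 1)"
        unfolding y_def anp by (simp add: right_diff_distrib ee p_def flip: mult.assoc)
      then show "(1 - p) * (e * a - scaleC z 1) = (1 - p) * (y - scaleC z 1)" by (simp add: pe)
    qed (simp_all add: right_diff_distrib left_diff_distrib scaleC_1_mult yp yh yea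
        scaleC.scale_right_diff_distrib)
  qed
  moreover have "a - a ^ (n + 2) * x = y"
    by (simp add: y_def p_def axe[symmetric] power_commutes mult.assoc) (metis mult.assoc power_commutes)
  moreover have "x * a * x = x" by (simp add: mult.assoc axe right_diff_distrib xe)
  ultimately show "gpi_Hirano_invertible a"
    unfolding gpi_Hirano_invertible_def using ax \<open>n > 0\<close> by auto
qed

subsection \<open>Shifted sums and products\<close>

text \<open>These are the elements whose product with every word of length \<open>j\<close> in
  \<open>a\<close>, \<open>b\<close> vanishes. In recursive form, one letter on the right visibly
  lowers the index by one.\<close>

primrec word_annihilator :: "'a::ring_1 \<Rightarrow> 'a \<Rightarrow> nat \<Rightarrow> 'a set" where
  "word_annihilator a b 0 = {0}"
| "word_annihilator a b (Suc j) = {y. y * a \<in> word_annihilator a b j \<and> y * b \<in> word_annihilator a b j}"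

lemma word_annihilatorI:
  assumes "\<And>ws. length ws = j \<Longrightarrow> set ws \<subseteq> {a, b} \<Longrightarrow> y * prod_list ws = 0"
  shows "y \<in> word_annihilator a b j"
  using assms
proof (induction j arbitrary: y)
  case 0
  from 0[of "[]"] show ?case by simp
next
  case (Suc j)
  have "y * c \<in> word_annihilator a b j" if "c \<in> {a, b}" for c
  proof (rule Suc.IH)
    fix ws :: "'a list" assume "length ws = j" "set ws \<subseteq> {a, b}"
    then show "y * c * prod_list ws = 0"
      using Suc.prems[of "c # ws"] that by (simp add: mult.assoc)
  qed
  then show ?case by simp
qed

lemma word_annihilator_add:
  "x \<in> word_annihilator a b j \<Longrightarrow> y \<in> word_annihilator a b j \<Longrightarrow> x + y \<in> word_annihilator a b j"
  by (induction j arbitrary: x y) (simp_all add: distrib_right)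

lemma word_annihilator_scaleC:
  "x \<in> word_annihilator a b j \<Longrightarrow> scaleC z x \<in> word_annihilator a b j"
  by (induction j arbitrary: x) (simp_all add: scaleC_mult_left)

lemma word_annihilator_Suc: "x \<in> word_annihilator a b j \<Longrightarrow> x \<in> word_annihilator a b (Suc j)"
  by (induction j arbitrary: x) simp_all

text \<open>Works because \<open>1 / (u - z) = (u / (u - z) - 1) / z\<close>, where the factor \<open>u\<close> lowers the index.\<close>

lemma word_annihilator_resolvent:
  assumes u: "\<And>j y. y \<in> word_annihilator a b (Suc j) \<Longrightarrow> y * u \<in> word_annihilator a b j"
    and inv: "ba_invertible (u - scaleC z 1)" and "z \<noteq> 0"
    and "y \<in> word_annihilator a b j"
  shows "y * ba_inverse (u - scaleC z 1) \<in> word_annihilator a b j"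
  using assms(4)
proof (induction j arbitrary: y)
  case (Suc j)
  define U where "U = ba_inverse (u - scaleC z 1)"
  have "(u - scaleC z 1) * U = 1" using inv by (simp add: U_def)
  then have "u * U - 1 = scaleC z U" by (simp add: left_diff_distrib scaleC_1_mult algebra_simps)
  then have "scaleC z (y * U) = y * u * U + scaleC (- 1) y"
    by (simp add: scaleC_one right_diff_distrib flip: scaleC_mult_right mult.assoc)
      (metis mult.assoc mult_1_right right_diff_distrib scaleC_mult_right)
  then have "y * U = scaleC (1 / z) (y * u * U + scaleC (- 1) y)"
    using \<open>z \<noteq> 0\<close> by (metis scaleC_scaleC scaleC_one nonzero_divide_eq_eq)
  moreover have "y * u * U \<in> word_annihilator a b (Suc j)"
    unfolding U_def by (rule word_annihilator_Suc[OF Suc.IH[OF u[OF Suc.prems]]])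
  ultimately show ?case
    unfolding U_def[symmetric]
    using word_annihilator_scaleC word_annihilator_add Suc.prems by metis
qed simp

text \<open>Each factor \<open>a * b * R\<close> lowers the index: \<open>a\<close> and
  \<open>R\<close> do not raise it and \<open>b\<close> takes off one. At index 0 only 0 is
  left.\<close>

lemma word_annihilator_mult_power:
  assumes R: "\<And>j y. y \<in> word_annihilator a b j \<Longrightarrow> y * R \<in> word_annihilator a b j"
    and "y \<in> word_annihilator a b j"
  shows "y * (a * b * R) ^ j = 0"
  using assms(2)
proof (induction j arbitrary: y)
  case (Suc j)
  have "y * a \<in> word_annihilator a b (Suc j)"
    using Suc.prems by (intro word_annihilator_Suc) simp
  then have "y * (a * b * R) \<in> word_annihilator a b j"
    by (simp add: R flip: mult.assoc)
  from Suc.IH[OF this] show ?case by (simp add: mult.assoc)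
qed simp

lemma ba_invertible_one_minus_word:
  assumes "\<And>j y. y \<in> word_annihilator a b j \<Longrightarrow> y * R \<in> word_annihilator a b j"
    and "a * b \<in> word_annihilator a b k"
  shows "ba_invertible (1 - a * b * R)"
proof (rule nilpotent_ba_invertible)
  show "(a * b * R) ^ Suc k = 0"
    using word_annihilator_mult_power[OF assms(1) assms(1)[OF assms(2)]] by simp
qed

section \<open>Transfer of invertibility between a - z, b - z and a + b - z\<close>

lemma shifted_mult:
  "(a - scaleC z 1) * (b - scaleC z 1) = a * b - scaleC z (a + b - scaleC z 1)"
  by (simp add: left_diff_distrib right_diff_distrib scaleC_1_mult scaleC.scale_right_diff_distrib
      scaleC_add_right scaleC_mult_left scaleC_mult_right scaleC_scaleC algebra_simps)

text \<open>Since B A inverts (a - z) (b - z), multiplying this product on the left by 1 - a b B A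
  subtracts exactly a b and leaves -z (a + b - z).\<close>

lemma ba_invertible_sum_shift:
  assumes ann: "a * b \<in> word_annihilator a b k" and "z \<noteq> 0"
    and a: "ba_invertible (a - scaleC z 1)" and b: "ba_invertible (b - scaleC z 1)"
  shows "ba_invertible (a + b - scaleC z 1)"
proof -
  define A B where "A = ba_inverse (a - scaleC z 1)" and "B = ba_inverse (b - scaleC z 1)"
  have AB: "A * (a - scaleC z 1) = 1" "B * (b - scaleC z 1) = 1"
    using a b by (simp_all add: A_def B_def)
  have "ba_invertible (1 - a * b * (B * A))"
  proof (rule ba_invertible_one_minus_word[OF _ ann])
    fix j y assume "y \<in> word_annihilator a b j"
    then show "y * (B * A) \<in> word_annihilator a b j"
      unfolding A_def B_def mult.assoc[symmetric]
      using a b \<open>z \<noteq> 0\<close> by (intro word_annihilator_resolvent) simp_all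
  qed
  then have "ba_invertible ((1 - a * b * (B * A)) * ((a - scaleC z 1) * (b - scaleC z 1)))"
    by (intro ba_invertible_mult a b)
  also have "(1 - a * b * (B * A)) * ((a - scaleC z 1) * (b - scaleC z 1)) =
      (a - scaleC z 1) * (b - scaleC z 1) - a * b * (B * (A * (a - scaleC z 1)) * (b - scaleC z 1))"
    by (simp only: left_diff_distrib[of 1] mult.assoc mult_1_left)
  also have "\<dots> = scaleC (- z) (a + b - scaleC z 1)"
    by (simp add: AB shifted_mult)
  finally show ?thesis using \<open>z \<noteq> 0\<close> by (simp only: ba_invertible_scaleC_iff neg_equal_0_iff_equal not_False_eq_True)
qed

text \<open>The same correction in reverse: (1 - a b C / z) (-z (a + b - z)) restores the term a b.
  It yields the product only, hence just a right inverse of a - z and a left inverse of b -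
  z.\<close>

lemma ba_invertible_shift_product:
  assumes ann: "a * b \<in> word_annihilator a b k" and "z \<noteq> 0"
    and c: "ba_invertible (a + b - scaleC z 1)"
  shows "ba_invertible ((a - scaleC z 1) * (b - scaleC z 1))"
proof -
  define C where "C = ba_inverse (a + b - scaleC z 1)"
  have C: "C * (a + b - scaleC z 1) = 1" using c by (simp add: C_def)
  have "ba_invertible (1 - a * b * scaleC (1 / z) C)"
  proof (rule ba_invertible_one_minus_word[OF _ ann])
    fix j y assume y: "y \<in> word_annihilator a b j"
    have "y * C \<in> word_annihilator a b j"
      unfolding C_def
      by (rule word_annihilator_resolvent[OF _ c \<open>z \<noteq> 0\<close> y])
        (simp add: distrib_left word_annihilator_add)
    then show "y * scaleC (1 / z) C \<in> word_annihilator a b j"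
      by (simp add: scaleC_mult_right word_annihilator_scaleC)
  qed
  moreover have "ba_invertible (scaleC (- z) (a + b - scaleC z 1))"
    using c \<open>z \<noteq> 0\<close> by (simp only: ba_invertible_scaleC_iff neg_equal_0_iff_equal not_False_eq_True)
  ultimately have "ba_invertible ((1 - a * b * scaleC (1 / z) C) * scaleC (- z) (a + b - scaleC z 1))"
    by (rule ba_invertible_mult)
  also have "(1 - a * b * scaleC (1 / z) C) * scaleC (- z) (a + b - scaleC z 1) =
      scaleC (- z) (a + b - scaleC z 1) + a * b * (C * (a + b - scaleC z 1))"
    using \<open>z \<noteq> 0\<close>
    by (simp only: left_diff_distrib[of 1] mult_1_left scaleC_mult_left scaleC_mult_right scaleC_scaleC mult.assoc)
      (simp add: scaleC_one scaleC.scale_right_diff_distrib scaleC_scaleC)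
  also have "\<dots> = (a - scaleC z 1) * (b - scaleC z 1)" by (simp add: C shifted_mult)
  finally show ?thesis .
qed

text \<open>A right invertible limit of invertible elements is invertible, so off \<open>Z\<close> the resolvent set is
  both open and closed; the complement of a finite subset of the plane is connected.\<close>

lemma ba_invertible_of_right_invertible:
  fixes a :: "'a::complex_banach_algebra_1"
  assumes "finite Z" and right: "\<And>z. z \<notin> Z \<Longrightarrow> \<exists>r. (a - scaleC z 1) * r = 1"
    and "z \<notin> Z"
  shows "ba_invertible (a - scaleC z 1)"
proof (rule ccontr)
  assume z: "\<not> ba_invertible (a - scaleC z 1)"
  define U where "U = {z. ba_invertible (a - scaleC z 1)}"
  have "open U"
  proof -
    have "open ((\<lambda>z. a - scaleC z 1) -` {x. ba_invertible x})"
      by (intro open_vimage open_ba_invertible continuous_intros)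
    then show ?thesis by (simp add: U_def vimage_def)
  qed
  have "open (- U - Z)"
  proof (rule openI)
    fix t assume t: "t \<in> - U - Z"
    then obtain r where r: "(a - scaleC t 1) * r = 1" using right by blast
    have pos: "0 < norm r + 1" by (rule add_nonneg_pos) auto
    \<comment> \<open>If a - s is invertible with s this close to t, then (a - s) r = 1 - h with
      \<open>norm h < 1\<close>. So r is invertible, and a - t is its inverse.\<close>
    have "ball t (1 / (norm r + 1)) \<inter> U = {}"
    proof (rule ccontr)
      assume "ball t (1 / (norm r + 1)) \<inter> U \<noteq> {}"
      then obtain s where s: "cmod (s - t) < 1 / (norm r + 1)" "ba_invertible (a - scaleC s 1)"
        by (auto simp: U_def dist_norm norm_minus_commute)
      define h where "h = scaleC (s - t) r"
      have "norm h \<le> cmod (s - t) * (norm r + 1)"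
        by (simp add: h_def norm_scaleC mult_left_mono)
      also have "\<dots> < 1" using s(1) pos by (simp add: pos_less_divide_eq)
      finally have "ba_invertible (1 - h)" by (rule neumann)
      moreover have "(a - scaleC s 1) * r = 1 - h"
        using r by (simp add: h_def left_diff_distrib scaleC_1_mult scaleC.scale_left_diff_distrib algebra_simps)
      ultimately have "ba_invertible r" using ba_invertible_of_mult[of "a - scaleC s 1" r] s(2) by simp
      then have r': "r * ba_inverse r = 1" "ba_inverse r * r = 1" by simp_all
      have "a - scaleC t 1 = (a - scaleC t 1) * r * ba_inverse r" by (simp only: mult.assoc r' mult_1_right)
      then have "a - scaleC t 1 = ba_inverse r" by (simp only: r mult_1_left)
      then have "ba_invertible (a - scaleC t 1)" using r' by (simp add: ba_invertibleI[of _ r])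
      with t show False by (simp add: U_def)
    qed
    moreover obtain d where "d > 0" "ball t d \<subseteq> - Z"
      using finite_imp_closed[OF \<open>finite Z\<close>] t open_contains_ball[of "- Z"] by (auto simp: open_Compl)
    ultimately show "\<exists>T>0. ball t T \<subseteq> - U - Z"
      using pos by (intro exI[of _ "min d (1 / (norm r + 1))"]) fastforce
  qed
  have "connected (UNIV - Z)"
    by (rule connected_open_delete_finite) (use \<open>finite Z\<close> in auto)
  moreover have "open (U - Z)" using \<open>open U\<close> \<open>finite Z\<close> by (simp add: open_Diff finite_imp_closed)
  moreover have "z \<in> (- U - Z) \<inter> (UNIV - Z)" using z \<open>z \<notin> Z\<close> by (simp add: U_def)
  moreover have "\<exists>t. t \<in> (U - Z) \<inter> (UNIV - Z)"
  proof -
    have "bounded Z" using \<open>finite Z\<close> by (rule finite_imp_bounded)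
    then obtain B where B: "\<And>t. t \<in> Z \<Longrightarrow> cmod t \<le> B" by (auto simp: bounded_iff)
    \<comment> \<open>Beyond all of \<open>Z\<close> and beyond \<open>norm a\<close>, where the
      Neumann series inverts a - t.\<close>
    define t where "t = complex_of_real (\<bar>B\<bar> + norm a + 1)"
    have "cmod t = \<bar>B\<bar> + norm a + 1" unfolding t_def norm_of_real by simp
    then have t: "B < cmod t" "norm a < cmod t" "0 < cmod t" using norm_ge_zero[of a] by linarith+
    then have "t \<notin> Z" "t \<noteq> 0" using B[of t] by auto
    have "norm (scaleC (1 / t) a) < 1" using t by (simp add: norm_scaleC norm_divide)
    then have "ba_invertible (scaleC (- t) (1 - scaleC (1 / t) a))"
      using \<open>t \<noteq> 0\<close> neumann(1) by (simp only: ba_invertible_scaleC_iff neg_equal_0_iff_equal not_False_eq_True)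
    then have "t \<in> U"
      using \<open>t \<noteq> 0\<close> by (simp add: U_def scaleC.scale_right_diff_distrib scaleC_scaleC scaleC_one)
    with \<open>t \<notin> Z\<close> show ?thesis by blast
  qed
  ultimately show False
    using connectedD[of "UNIV - Z" "U - Z" "- U - Z"] \<open>open (- U - Z)\<close> by auto
qed

section \<open>Comparison of the spectra and the theorem\<close>

lemma finite_fixed_points_power:
  assumes "0 < n"
  shows "finite {z :: complex. z ^ (n + 1) = z}"
proof (rule finite_subset)
  show "{z :: complex. z ^ (n + 1) = z} \<subseteq> insert 0 {z. z ^ n = 1}" by auto
  show "finite (insert 0 {z :: complex. z ^ n = 1})" using assms by (simp add: finite_nth_roots)
qed

lemma fixed_point_power_mult:
  fixes z :: complex
  assumes "z ^ (n + 1) = z"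
  shows "z ^ (n * m + 1) = z"
proof (cases "z = 0")
  case False
  with assms have "z ^ n = 1" by simp
  then show ?thesis by (simp add: power_mult)
qed simp

lemma gpi_Hirano_sum:
  assumes ann: "a * b \<in> word_annihilator a b k"
  shows "(gpi_Hirano_invertible a \<and> gpi_Hirano_invertible b) \<longleftrightarrow> gpi_Hirano_invertible (a + b)"
proof
  assume "gpi_Hirano_invertible a \<and> gpi_Hirano_invertible b"
  then obtain n m where n: "n > 0" "\<And>z. z \<in> ba_spectrum a \<Longrightarrow> z ^ (n + 1) = z"
    and m: "m > 0" "\<And>z. z \<in> ba_spectrum b \<Longrightarrow> z ^ (m + 1) = z"
    unfolding gpi_Hirano_iff_spectrum by blast
  \<comment> \<open>The exponents for \<open>a\<close> and \<open>b\<close> may differ; a nonzero z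
    with z^n = 1 or z^m = 1 satisfies z^(n m) = 1.\<close>
  have "z ^ (n * m + 1) = z" if "z \<in> ba_spectrum (a + b)" for z
  proof (cases "z = 0")
    case False
    then have "z \<in> ba_spectrum a \<or> z \<in> ba_spectrum b"
      using ba_invertible_sum_shift[OF ann, of z] that by (auto simp: ba_spectrum_def)
    then show ?thesis
      using fixed_point_power_mult[of z n m] fixed_point_power_mult[of z m n] n(2) m(2)
      by (metis mult.commute)
  qed simp
  moreover have "0 < n * m" using n m by simp
  ultimately show "gpi_Hirano_invertible (a + b)" unfolding gpi_Hirano_iff_spectrum by blast
next
  assume "gpi_Hirano_invertible (a + b)"
  then obtain n where n: "n > 0" "\<And>z. z \<in> ba_spectrum (a + b) \<Longrightarrow> z ^ (n + 1) = z"
    unfolding gpi_Hirano_iff_spectrum by blast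
  define Z where "Z = {z :: complex. z ^ (n + 1) = z}"
  have prod: "ba_invertible ((a - scaleC z 1) * (b - scaleC z 1))" if "z \<notin> Z" for z
  proof (rule ba_invertible_shift_product[OF ann])
    show "z \<noteq> 0" using that by (auto simp: Z_def)
    show "ba_invertible (a + b - scaleC z 1)" using that n(2) by (auto simp: Z_def ba_spectrum_def)
  qed
  have "finite Z" unfolding Z_def by (rule finite_fixed_points_power[OF n(1)])
  have a: "ba_invertible (a - scaleC z 1)" if "z \<notin> Z" for z
  proof (rule ba_invertible_of_right_invertible[OF \<open>finite Z\<close> _ that])
    show "\<exists>r. (a - scaleC z 1) * r = 1" if "z \<notin> Z" for z
      using ba_inverse_right[OF prod[OF that]] by (metis mult.assoc)
  qed
  \<comment> \<open>With a - z now two-sided invertible, it cancels from the product; the same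
    \<open>n\<close> serves both elements.\<close>
  have b: "ba_invertible (b - scaleC z 1)" if "z \<notin> Z" for z
    using ba_invertible_of_mult[OF prod a] that by blast
  from a b show "gpi_Hirano_invertible a \<and> gpi_Hirano_invertible b"
    unfolding gpi_Hirano_iff_spectrum using n(1) by (auto simp: Z_def ba_spectrum_def)
qed

theorem theorem3p2:
  fixes a b :: "'a::complex_banach_algebra_1" and k :: nat
  assumes "k > 0"
    and "\<forall>f::nat \<Rightarrow> 'a. (\<forall>i\<in>{1..k}. f i \<in> {a, b}) \<longrightarrow>
            a * b * (\<Prod>i\<leftarrow>[1..<k+1]. f i) = 0"
  shows "(gpi_Hirano_invertible a \<and> gpi_Hirano_invertible b) \<longleftrightarrow> gpi_Hirano_invertible (a + b)"
proof (rule gpi_Hirano_sum)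
  show "a * b \<in> word_annihilator a b k"
  proof (rule word_annihilatorI)
    fix ws :: "'a list" assume ws: "length ws = k" "set ws \<subseteq> {a, b}"
    \<comment> \<open>The hypothesis numbers letters from 1, list positions start at 0.\<close>
    have "map (\<lambda>i. ws ! (i - 1)) [1..<k + 1] = ws"
      using ws(1) by (intro nth_equalityI) (auto simp del: upt_Suc)
    moreover have "\<forall>i\<in>{1..k}. ws ! (i - 1) \<in> {a, b}"
    proof
      fix i assume "i \<in> {1..k}"
      then have "ws ! (i - 1) \<in> set ws" using ws(1) by (intro nth_mem) auto
      then show "ws ! (i - 1) \<in> {a, b}" using ws(2) by blast
    qed
    ultimately show "a * b * prod_list ws = 0" using assms(2) by metis
  qed
qed

end
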